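(* Consider the multi-converter power system $\dot z=f(z,u)$ defined in the context. Let steady state angles $\gamma^*\in\mathbb T^n$ (i.e. with $\dot\gamma^*=0$) be given. Then a feasible input $\mathbf u\in\mathbb R^n$ is given by $$\mathbf u=\xi\,\mathrm{Rot}(\gamma^* )^\top\,Y\,\mathrm{Rot}(\gamma^* )\,\mathds 1_n,$$ where $\xi=\mu^2\frac{v_{dc}^*}{4}>0$ and $Y=\big(Z_R+(Z_C+\mathbf B Z_\ell^{-1}\mathbf B^\top)^{-1}\big)^{-1}$.
   Context: Graph: an undirected graph with $n$ nodes and $m$ edges, arbitrary topology, with (arbitrarily oriented) incidence matrix $\mathcal B\in\mathbb R^{n\times m}$ (entries in $\{-1,0,1\}$); $\mathbf B=\mathcal B\otimes I_2$. Notation: $\mathbf I$ is an identity matrix of suitable size, $J_2=\begin{bmatrix}0&-1\\1&0\end{bmatrix}$, $\mathbf J=\mathbf I\otimes J_2$, $r(\gamma_k)=(-\sin\gamma_k,\cos\gamma_k)^\top$, and $\mathrm{Rot}(\gamma)\in\mathbb R^{2n\times n}$ is the block-diagonal matrix with $k$-th diagonal block $r(\gamma_k)$. $\mathds 1_n$ is the all-ones vector; $\mathbb T^n=(\mathbb S^1)^n$. Constants: $\eta,C_{dc},K_p,L,C,R,G,R_\ell,L_\ell,\omega^*,v_{dc}^*>0$ and $\mu\in(0,1)$. Put $Z_R=R\,\mathbf I+L\omega^*\mathbf J$, $Z_C=G\,\mathbf I+C\omega^*\mathbf J$, $Z_\ell=R_\ell\mathbf I+L_\ell\omega^*\mathbf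 J$. Dynamics ($n$ identical DC/AC converters under matching control, $m$ identical RL lines): the state is $z=(\gamma,\tilde v_{dc},i,v,i_\ell)\in\mathbb T^n\times\mathbb R^n\times\mathbb R^{2n}\times\mathbb R^{2n}\times\mathbb R^{2m}$ and, with $\tilde v_{dc}=v_{dc}-v_{dc}^*\mathds 1_n$, $\dot z=f(z,u)$ is $$\dot\gamma=\eta\tilde v_{dc},\quad C_{dc}\dot{\tilde v}_{dc}=-K_p\tilde v_{dc}-\tfrac12\mu\,\mathrm{Rot}(\gamma)^\top i+\mathbf u,$$ $$L\dot i=-Z_R i+\tfrac12\mu\,\mathrm{Rot}(\gamma)(\tilde v_{dc}+v_{dc}^*\mathds 1_n)-v,\quad C\dot v=-Z_C v+i-\mathbf B i_\ell,\quad L_\ell\dot i_\ell=-Z_\ell i_\ell+\mathbf B^\top v,$$ where $\mathbf u\in\mathbb R^n$ is a constant input and $u$ denotes $\mathbf u$ placed in the $\tilde v_{dc}$ component (zero elsewhere). An input $\mathbf u$ is feasible for the steady state angles $\gamma^*$ if there is a steady state $z^*$, $f(z^*,u)=0$, whose angle component is $\gamma^*$. *)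

theory Defs
  imports Complex_Main "Jordan_Normal_Form.Gauss_Jordan_Elimination"
begin

text \<open>The circle, as the reals modulo \<open>2 * pi\<close>. A point of the \<open>n\<close>-torus is a vector of
  \<open>n\<close> angles; its velocity is a real vector.\<close>

definition angle_eq :: "real \<Rightarrow> real \<Rightarrow> bool" where
  "angle_eq x y \<longleftrightarrow> (\<exists>k::int. x = y + 2 * pi * of_int k)"

lemma equivp_angle_eq: "equivp angle_eq"
proof (rule equivpI)
  show "reflp angle_eq"
    unfolding reflp_def angle_eq_def by (intro allI exI[of _ 0]) simp
  show "symp angle_eq"
  proof (rule sympI)
    fix x y assume "angle_eq x y"
    then obtain k :: int where "x = y + 2 * pi * of_int k" by (auto simp: angle_eq_def)
    then have "y = x + 2 * pi * of_int (- k)" by simp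
    then show "angle_eq y x" unfolding angle_eq_def by blast
  qed
  show "transp angle_eq"
  proof (rule transpI)
    fix x y z assume "angle_eq x y" "angle_eq y z"
    then obtain k l :: int where "x = y + 2 * pi * of_int k" "y = z + 2 * pi * of_int l"
      unfolding angle_eq_def by blast
    then have "x = z + 2 * pi * of_int (k + l)" by (simp add: algebra_simps)
    then show "angle_eq x z" unfolding angle_eq_def by blast
  qed
qed

quotient_type angle = real / angle_eq
  by (rule equivp_angle_eq)

lift_definition angle_sin :: "angle \<Rightarrow> real" is sin
  by (auto simp: angle_eq_def sin_add sin_int_2pin cos_int_2pin)

lift_definition angle_cos :: "angle \<Rightarrow> real" is cos
  by (auto simp: angle_eq_def cos_add sin_int_2pin cos_int_2pin)

text \<open>Meaningful for invertible \<open>A\<close> only (\<open>mat_inverse A\<close> is \<open>None\<close> otherwise).\<close>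

definition mat_inv :: "real mat \<Rightarrow> real mat" where
  "mat_inv A = the (mat_inverse A)"

lemma mat_inv:
  assumes A: "A \<in> carrier_mat n n" and inv: "invertible_mat A"
  shows "A * mat_inv A = 1\<^sub>m n" "mat_inv A * A = 1\<^sub>m n" "mat_inv A \<in> carrier_mat n n"
proof -
  from A inv obtain B where AB: "A * B = 1\<^sub>m n" and BA: "B * A = 1\<^sub>m (dim_row B)"
    unfolding invertible_mat_def inverts_mat_def by (metis carrier_matD(1))
  have "dim_col B = n" using arg_cong[OF AB, of dim_col] by simp
  moreover have "dim_row B = n" using arg_cong[OF BA, of dim_col] A by simp
  ultimately have B: "B \<in> carrier_mat n n" and BA': "B * A = 1\<^sub>m n"
    using BA by auto
  have "A \<in> Units (ring_mat TYPE(real) n ())"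
    unfolding Units_def ring_mat_simps using A B AB BA' by blast
  with mat_inverse(1)[OF A] obtain C where C: "mat_inverse A = Some C"
    by (metis option.exhaust)
  with mat_inverse(2)[OF A C]
  show "A * mat_inv A = 1\<^sub>m n" "mat_inv A * A = 1\<^sub>m n" "mat_inv A \<in> carrier_mat n n"
    unfolding mat_inv_def by simp_all
qed

definition kronecker :: "real mat \<Rightarrow> real mat \<Rightarrow> real mat" (infixl "\<otimes>\<^sub>K" 72) where
  "A \<otimes>\<^sub>K B = mat (dim_row A * dim_row B) (dim_col A * dim_col B)
     (\<lambda>(i, j). A $$ (i div dim_row B, j div dim_col B) * B $$ (i mod dim_row B, j mod dim_col B))"

definition J2 :: "real mat" where
  "J2 = mat_of_rows_list 2 [[0, -1], [1, 0]]"

definition ones :: "nat \<Rightarrow> real vec" where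
  "ones n = vec n (\<lambda>_. 1)"

definition r_vec :: "angle \<Rightarrow> real vec" where
  "r_vec \<theta> = vec_of_list [- angle_sin \<theta>, angle_cos \<theta>]"

definition Rot :: "angle vec \<Rightarrow> real mat" where
  "Rot \<gamma> = mat (2 * dim_vec \<gamma>) (dim_vec \<gamma>)
     (\<lambda>(i, k). if i div 2 = k then r_vec (\<gamma> $ k) $ (i mod 2) else 0)"

text \<open>Nodes are \<open>0, ..., n-1\<close>, edges are \<open>0, ..., m-1\<close>, and \<open>ends e\<close> is the unordered pair of
  endpoints of the edge \<open>e\<close>. Parallel edges are not excluded; the simple graphs are those with
  \<open>ends\<close> injective on the edges.\<close>

definition undirected_graph :: "nat \<Rightarrow> nat \<Rightarrow> (nat \<Rightarrow> nat set) \<Rightarrow> bool" where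
  "undirected_graph n m ends \<longleftrightarrow> (\<forall>e<m. ends e \<subseteq> {..<n} \<and> card (ends e) = 2)"

definition incidence_matrix :: "nat \<Rightarrow> nat \<Rightarrow> (nat \<Rightarrow> nat set) \<Rightarrow> real mat \<Rightarrow> bool" where
  "incidence_matrix n m ends B \<longleftrightarrow> B \<in> carrier_mat n m \<and>
     (\<forall>e<m. \<exists>s t. ends e = {s, t} \<and> s \<noteq> t \<and> B $$ (s, e) = 1 \<and> B $$ (t, e) = -1 \<and>
        (\<forall>k<n. k \<notin> {s, t} \<longrightarrow> B $$ (k, e) = 0))"

record params =
  eta :: real
  C_dc :: real
  K_p :: real
  L_f :: real
  C_f :: real
  R_f :: real
  G_f :: real
  R_line :: real
  L_line :: real
  omega_ref :: real
  v_dc_ref :: real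
  mu :: real

definition valid_params :: "params \<Rightarrow> bool" where
  "valid_params P \<longleftrightarrow> eta P > 0 \<and> C_dc P > 0 \<and> K_p P > 0 \<and> L_f P > 0 \<and> C_f P > 0 \<and>
     R_f P > 0 \<and> G_f P > 0 \<and> R_line P > 0 \<and> L_line P > 0 \<and> omega_ref P > 0 \<and>
     v_dc_ref P > 0 \<and> 0 < mu P \<and> mu P < 1"

definition impedance :: "nat \<Rightarrow> real \<Rightarrow> real \<Rightarrow> real mat" where
  "impedance N a b = a \<cdot>\<^sub>m 1\<^sub>m (2 * N) + b \<cdot>\<^sub>m (1\<^sub>m N \<otimes>\<^sub>K J2)"

definition Z_R :: "params \<Rightarrow> nat \<Rightarrow> real mat" where
  "Z_R P n = impedance n (R_f P) (L_f P * omega_ref P)"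

definition Z_C :: "params \<Rightarrow> nat \<Rightarrow> real mat" where
  "Z_C P n = impedance n (G_f P) (C_f P * omega_ref P)"

definition Z_line :: "params \<Rightarrow> nat \<Rightarrow> real mat" where
  "Z_line P m = impedance m (R_line P) (L_line P * omega_ref P)"

definition B_ext :: "real mat \<Rightarrow> real mat" where
  "B_ext B = B \<otimes>\<^sub>K 1\<^sub>m 2"

record state =
  angles :: "angle vec"
  dc_dev :: "real vec"
  i_ac :: "real vec"
  v_ac :: "real vec"
  i_line :: "real vec"

definition state_space :: "nat \<Rightarrow> nat \<Rightarrow> state set" where
  "state_space n m = {z. angles z \<in> carrier_vec n \<and> dc_dev z \<in> carrier_vec n \<and>
     i_ac z \<in> carrier_vec (2 * n) \<and> v_ac z \<in> carrier_vec (2 * n) \<and> i_line z \<in> carrier_vec (2 * m)}"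

text \<open>Each equation is solved for the derivative, i.e. divided by \<open>C_dc\<close>, \<open>L\<close>, \<open>C\<close>
  or \<open>L_line\<close>; the dimensions \<open>n\<close>, \<open>m\<close> are read off the incidence matrix \<open>B\<close>.\<close>

definition vector_field ::
  "params \<Rightarrow> real mat \<Rightarrow> state \<Rightarrow> real vec \<Rightarrow> real vec \<times> real vec \<times> real vec \<times> real vec \<times> real vec"
where
  "vector_field P B z u =
    (let n = dim_row B; m = dim_col B in
     (eta P \<cdot>\<^sub>v dc_dev z,
      (1 / C_dc P) \<cdot>\<^sub>v
        (- (K_p P \<cdot>\<^sub>v dc_dev z)
         - (mu P / 2) \<cdot>\<^sub>v (transpose_mat (Rot (angles z)) *\<^sub>v i_ac z) + u),
      (1 / L_f P) \<cdot>\<^sub>v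
        (- (Z_R P n *\<^sub>v i_ac z)
         + (mu P / 2) \<cdot>\<^sub>v (Rot (angles z) *\<^sub>v (dc_dev z + v_dc_ref P \<cdot>\<^sub>v ones n)) - v_ac z),
      (1 / C_f P) \<cdot>\<^sub>v (- (Z_C P n *\<^sub>v v_ac z) + i_ac z - B_ext B *\<^sub>v i_line z),
      (1 / L_line P) \<cdot>\<^sub>v (- (Z_line P m *\<^sub>v i_line z) + transpose_mat (B_ext B) *\<^sub>v v_ac z)))"

definition steady_state :: "params \<Rightarrow> real mat \<Rightarrow> state \<Rightarrow> real vec \<Rightarrow> bool" where
  "steady_state P B z u \<longleftrightarrow>
    (let n = dim_row B; m = dim_col B in
     z \<in> state_space n m \<and>
     vector_field P B z u = (0\<^sub>v n, 0\<^sub>v n, 0\<^sub>v (2 * n), 0\<^sub>v (2 * n), 0\<^sub>v (2 * m)))"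

definition feasible_input :: "params \<Rightarrow> real mat \<Rightarrow> angle vec \<Rightarrow> real vec \<Rightarrow> bool" where
  "feasible_input P B \<gamma> u \<longleftrightarrow>
     u \<in> carrier_vec (dim_row B) \<and> (\<exists>z. steady_state P B z u \<and> angles z = \<gamma>)"

definition Z_net :: "params \<Rightarrow> real mat \<Rightarrow> real mat" where
  "Z_net P B = Z_C P (dim_row B)
     + B_ext B * mat_inv (Z_line P (dim_col B)) * transpose_mat (B_ext B)"

definition Z_total :: "params \<Rightarrow> real mat \<Rightarrow> real mat" where
  "Z_total P B = Z_R P (dim_row B) + mat_inv (Z_net P B)"

definition Y :: "params \<Rightarrow> real mat \<Rightarrow> real mat" where
  "Y P B = mat_inv (Z_total P B)"

definition xi :: "params \<Rightarrow> real" where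
  "xi P = (mu P)\<^sup>2 * (v_dc_ref P / 4)"

end

theory Submission
  imports Defs "Jordan_Normal_Form.Determinant"
begin

text \<open>Every impedance has a positive definite symmetric part: the resistance contributes a positive
  multiple of the identity and the reactance is skew-symmetric. This property is inherited by
  inverses and by sums with \<open>M * A * M\<^sup>T\<close>, so the line, network and total
  impedances are all invertible. A steady state is then found by choosing a zero voltage deviation
  and eliminating the currents and voltages one after the other.\<close>

definition pos_quad_form :: "nat \<Rightarrow> real mat \<Rightarrow> bool" where
  "pos_quad_form n A \<longleftrightarrow>
     A \<in> carrier_mat n n \<and> (\<forall>x\<in>carrier_vec n. x \<noteq> 0\<^sub>v n \<longrightarrow> x \<bullet> (A *\<^sub>v x) > 0)"

lemma pos_quad_form_carrier: "pos_quad_form n A \<Longrightarrow> A \<in> carrier_mat n n"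
  by (simp add: pos_quad_form_def)

lemma pos_quad_form_nonneg:
  assumes "pos_quad_form n A" "x \<in> carrier_vec n"
  shows "x \<bullet> (A *\<^sub>v x) \<ge> 0"
proof (cases "x = 0\<^sub>v n")
  case True
  have "A *\<^sub>v x \<in> carrier_vec n"
    using assms by (auto simp: pos_quad_form_def)
  then show ?thesis using True by simp
next
  case False
  then show ?thesis using assms by (auto simp: pos_quad_form_def intro: less_imp_le)
qed

text \<open>A nonzero kernel vector would give the quadratic form the value zero, so the determinant
  cannot vanish.\<close>

lemma pos_quad_form_invertible:
  assumes "pos_quad_form n A"
  shows "invertible_mat A"
proof -
  have A: "A \<in> carrier_mat n n" by (rule pos_quad_form_carrier[OF assms])
  have "det A \<noteq> 0"
  proof
    assume "det A = 0"
    then obtain x where x: "x \<in> carrier_vec n" "x \<noteq> 0\<^sub>v n" "A *\<^sub>v x = 0\<^sub>v n"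
      using det_0_iff_vec_prod_zero[OF A] by blast
    then have "x \<bullet> (A *\<^sub>v x) = 0" by simp
    then show False using assms x by (auto simp: pos_quad_form_def)
  qed
  from det_non_zero_imp_unit[OF A this] obtain C
    where "C \<in> carrier_mat n n" "C * A = 1\<^sub>m n" "A * C = 1\<^sub>m n"
    by (auto simp: Units_def ring_mat_simps)
  then show ?thesis
    using A unfolding invertible_mat_def inverts_mat_def by auto
qed

text \<open>The substitution \<open>x = A *\<^sub>v y\<close> turns the form of the inverse at
  \<open>x\<close> into the form of \<open>A\<close> at \<open>y\<close>, up to the order of the
  scalar product.\<close>

lemma pos_quad_form_mat_inv:
  assumes "pos_quad_form n A"
  shows "pos_quad_form n (mat_inv A)"
proof -
  have A: "A \<in> carrier_mat n n" by (rule pos_quad_form_carrier[OF assms])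
  note inv = mat_inv[OF A pos_quad_form_invertible[OF assms]]
  have "x \<bullet> (mat_inv A *\<^sub>v x) > 0" if x: "x \<in> carrier_vec n" "x \<noteq> 0\<^sub>v n" for x
  proof -
    define y where "y = mat_inv A *\<^sub>v x"
    have y: "y \<in> carrier_vec n" using inv(3) x by (simp add: y_def)
    have xy: "x = A *\<^sub>v y"
      using A inv x by (simp add: y_def flip: assoc_mult_mat_vec)
    have "y \<noteq> 0\<^sub>v n"
      using x(2) A by (auto simp: xy)
    then have "y \<bullet> (A *\<^sub>v y) > 0" using assms y by (auto simp: pos_quad_form_def)
    then show ?thesis
      using x(1) y by (simp add: y_def[symmetric] xy[symmetric] comm_scalar_prod)
  qed
  with inv(3) show ?thesis by (simp add: pos_quad_form_def)
qed

text \<open>Semidefiniteness of \<open>C\<close> is the right generality for the line network: its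
  contribution to \<open>Z_net\<close> vanishes on voltages that agree at all nodes, where the
  transposed incidence matrix gives zero.\<close>

lemma pos_quad_form_add_nonneg:
  assumes "pos_quad_form n A" "C \<in> carrier_mat n n"
    and "\<And>x. x \<in> carrier_vec n \<Longrightarrow> x \<bullet> (C *\<^sub>v x) \<ge> 0"
  shows "pos_quad_form n (A + C)"
proof -
  have A: "A \<in> carrier_mat n n" by (rule pos_quad_form_carrier[OF assms(1)])
  have "x \<bullet> ((A + C) *\<^sub>v x) > 0" if "x \<in> carrier_vec n" "x \<noteq> 0\<^sub>v n" for x
  proof -
    have "x \<bullet> ((A + C) *\<^sub>v x) = x \<bullet> (A *\<^sub>v x) + x \<bullet> (C *\<^sub>v x)"
      using A assms(2) that(1)
      by (simp add: add_mult_distrib_mat_vec scalar_prod_add_distrib[of _ n])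
    moreover have "x \<bullet> (A *\<^sub>v x) > 0" using assms(1) that by (auto simp: pos_quad_form_def)
    ultimately show ?thesis using assms(3)[OF that(1)] by linarith
  qed
  with A assms(2) show ?thesis by (simp add: pos_quad_form_def)
qed

lemma mult_mat3_vec:
  assumes "M \<in> carrier_mat k l" "A \<in> carrier_mat l m" "N \<in> carrier_mat m n" "x \<in> carrier_vec n"
  shows "(M * A * N) *\<^sub>v x = M *\<^sub>v (A *\<^sub>v (N *\<^sub>v x))"
  using assms assoc_mult_mat_vec[of "M * A" k m N n x] assoc_mult_mat_vec[of M k l A m "N *\<^sub>v x"]
  by (simp del: assoc_mult_mat assoc_mult_mat_vec)

text \<open>Moving \<open>M\<close> across the scalar product leaves the form of \<open>A\<close> at
  \<open>M\<^sup>T *\<^sub>v x\<close>. This vector may be zero although \<open>x\<close> is not,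
  hence the weak inequality.\<close>

lemma congruence_quad_form_nonneg:
  assumes "pos_quad_form m A" "M \<in> carrier_mat n m" "x \<in> carrier_vec n"
  shows "x \<bullet> ((M * A * M\<^sup>T) *\<^sub>v x) \<ge> 0"
proof -
  have A: "A \<in> carrier_mat m m" by (rule pos_quad_form_carrier[OF assms(1)])
  have y: "M\<^sup>T *\<^sub>v x \<in> carrier_vec m" using assms(2,3) by simp
  have "(M * A * M\<^sup>T) *\<^sub>v x = M *\<^sub>v (A *\<^sub>v (M\<^sup>T *\<^sub>v x))"
    using A assms(2,3) by (intro mult_mat3_vec) auto
  then have "x \<bullet> ((M * A * M\<^sup>T) *\<^sub>v x) = (M\<^sup>T *\<^sub>v x) \<bullet> (A *\<^sub>v (M\<^sup>T *\<^sub>v x))"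
    using transpose_vec_mult_scalar[OF assms(2) _ assms(3), of "A *\<^sub>v (M\<^sup>T *\<^sub>v x)"] A y by simp
  then show ?thesis using pos_quad_form_nonneg[OF assms(1) y] by simp
qed

text \<open>Transposing \<open>K\<close> across the scalar product shows that the value equals its
  own negative.\<close>

lemma skew_quad_form_zero:
  fixes K :: "real mat"
  assumes K: "K \<in> carrier_mat n n" and skew: "K\<^sup>T = - K" and x: "x \<in> carrier_vec n"
  shows "x \<bullet> (K *\<^sub>v x) = 0"
proof -
  have Kx: "K *\<^sub>v x \<in> carrier_vec n" using K x by simp
  have "x \<bullet> (K *\<^sub>v x) = (- K *\<^sub>v x) \<bullet> x"
    using transpose_vec_mult_scalar[OF K x x] skew by simp
  also have "\<dots> = - (x \<bullet> (K *\<^sub>v x))"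
    using K x Kx comm_scalar_prod[OF Kx x] by simp
  finally show ?thesis by simp
qed

lemma kronecker_J2_carrier: "1\<^sub>m N \<otimes>\<^sub>K J2 \<in> carrier_mat (2 * N) (2 * N)"
  by (rule carrier_matI) (simp_all add: kronecker_def J2_def mat_of_rows_list_def)

text \<open>Transposition acts on the two factors separately: the identity selecting the block is
  symmetric, and \<open>J2\<close> inside the block changes sign.\<close>

lemma kronecker_J2_skew: "(1\<^sub>m N \<otimes>\<^sub>K J2)\<^sup>T = - (1\<^sub>m N \<otimes>\<^sub>K J2)"
proof -
  have J2: "J2 $$ (q, p) = - J2 $$ (p, q)" if "p < 2" "q < 2" for p q
    using that by (auto simp: J2_def mat_of_rows_list_def less_2_cases_iff)
  have dims: "dim_row J2 = 2" "dim_col J2 = 2"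
    by (simp_all add: J2_def mat_of_rows_list_def)
  show ?thesis
  proof (rule eq_matI)
    fix i j
    assume "i < dim_row (- (1\<^sub>m N \<otimes>\<^sub>K J2))" "j < dim_col (- (1\<^sub>m N \<otimes>\<^sub>K J2))"
    then show "(1\<^sub>m N \<otimes>\<^sub>K J2)\<^sup>T $$ (i, j) = (- (1\<^sub>m N \<otimes>\<^sub>K J2)) $$ (i, j)"
      using J2[of "i mod 2" "j mod 2"] by (simp add: kronecker_def dims less_mult_imp_div_less)
  qed (simp_all add: kronecker_def dims)
qed

lemma impedance_carrier: "impedance N a b \<in> carrier_mat (2 * N) (2 * N)"
  using kronecker_J2_carrier by (simp add: impedance_def)

text \<open>The reactance is skew-symmetric and drops out of the quadratic form, which leaves the
  resistance times the squared norm.\<close>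

lemma pos_quad_form_impedance:
  assumes "a > 0"
  shows "pos_quad_form (2 * N) (impedance N a b)"
proof -
  let ?K = "1\<^sub>m N \<otimes>\<^sub>K J2"
  have K: "?K \<in> carrier_mat (2 * N) (2 * N)" by (rule kronecker_J2_carrier)
  have "x \<bullet> (impedance N a b *\<^sub>v x) > 0" if x: "x \<in> carrier_vec (2 * N)" "x \<noteq> 0\<^sub>v (2 * N)" for x
  proof -
    have smult: "(c \<cdot>\<^sub>m A) *\<^sub>v x = c \<cdot>\<^sub>v (A *\<^sub>v x)" if "A \<in> carrier_mat (2 * N) (2 * N)" for c A
      using that x(1) by (intro eq_vecI) auto
    have "impedance N a b *\<^sub>v x = a \<cdot>\<^sub>v x + b \<cdot>\<^sub>v (?K *\<^sub>v x)"
      using K x(1) unfolding impedance_def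
      by (simp add: add_mult_distrib_mat_vec[of _ "2 * N" "2 * N"] smult)
    then have "x \<bullet> (impedance N a b *\<^sub>v x) = a * (x \<bullet> x)"
      using K x(1) skew_quad_form_zero[OF K kronecker_J2_skew x(1)]
      by (simp add: scalar_prod_add_distrib[of _ "2 * N"])
    \<comment> \<open>Over the reals conjugation is the identity, so the library fact on
      \<open>x\<close> and its conjugate applies.\<close>
    moreover have "x \<bullet> x > 0"
      using conjugate_square_greater_0_vec[OF x(1)] x(2) by simp
    ultimately show ?thesis using assms by simp
  qed
  then show ?thesis using impedance_carrier by (simp add: pos_quad_form_def)
qed

text \<open>The invertibility claims ensure that each of the three uses of \<open>mat_inv\<close>
  inside \<open>Y\<close> denotes a true inverse.\<close>

theorem mainTheorem2:
  fixes P :: params and n m :: nat and ends :: "nat \<Rightarrow> nat set"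
    and B :: "real mat" and \<gamma> :: "angle vec"
  assumes "valid_params P"
    and "undirected_graph n m ends"
    and "incidence_matrix n m ends B"
    and "\<gamma> \<in> carrier_vec n"
  shows "xi P > 0
    \<and> invertible_mat (Z_line P m) \<and> invertible_mat (Z_net P B) \<and> invertible_mat (Z_total P B)
    \<and> feasible_input P B \<gamma>
        (xi P \<cdot>\<^sub>v ((transpose_mat (Rot \<gamma>) * Y P B * Rot \<gamma>) *\<^sub>v ones n))"
proof -
  have dimB: "dim_row B = n" "dim_col B = m"
    using assms(3) by (auto simp: incidence_matrix_def)
  have BE: "B_ext B \<in> carrier_mat (2 * n) (2 * m)"
    by (simp add: B_ext_def kronecker_def dimB mult.commute)
  have R: "Rot \<gamma> \<in> carrier_mat (2 * n) n" using assms(4) by (simp add: Rot_def)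
  have RT: "(Rot \<gamma>)\<^sup>T \<in> carrier_mat n (2 * n)" using R by simp
  have ones: "ones n \<in> carrier_vec n" by (simp add: ones_def)
  have pos: "pos_quad_form (2 * m) (Z_line P m)" "pos_quad_form (2 * n) (Z_C P n)"
    "pos_quad_form (2 * n) (Z_R P n)"
    using assms(1)
    by (simp_all add: valid_params_def Z_line_def Z_C_def Z_R_def pos_quad_form_impedance)
  \<comment> \<open>Strict positivity comes from \<open>Z_C\<close>; the lines add a congruence of
    the inverse line impedance, which is semidefinite.\<close>
  have net: "pos_quad_form (2 * n) (Z_net P B)"
    unfolding Z_net_def dimB
    using pos_quad_form_mat_inv[OF pos(1)] BE
    by (intro pos_quad_form_add_nonneg[OF pos(2)] congruence_quad_form_nonneg)
      (auto dest: pos_quad_form_carrier)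
  have total: "pos_quad_form (2 * n) (Z_total P B)"
    unfolding Z_total_def dimB
    using pos_quad_form_mat_inv[OF net]
    by (intro pos_quad_form_add_nonneg[OF pos(3)] pos_quad_form_nonneg)
      (auto dest: pos_quad_form_carrier)
  note C = pos[THEN pos_quad_form_carrier] net[THEN pos_quad_form_carrier]
    total[THEN pos_quad_form_carrier]
  note inv_line = mat_inv[OF C(1) pos_quad_form_invertible[OF pos(1)]]
  note inv_net = mat_inv[OF C(4) pos_quad_form_invertible[OF net]]
  note inv_total = mat_inv[OF C(5) pos_quad_form_invertible[OF total], folded Y_def]

  \<comment> \<open>The witnesses come from elimination. With zero voltage deviation the converters
    act as the AC source \<open>e\<close>. The line equation gives \<open>l\<close> from
    \<open>v\<close>, the node equation then reads \<open>Z_net\<close> times \<open>v\<close>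
    equals \<open>i\<close>, and the filter equation becomes \<open>Z_total\<close> times
    \<open>i\<close> equals \<open>e\<close>. Solving backwards yields \<open>i\<close>,
    \<open>v\<close> and \<open>l\<close>.\<close>
  define e where "e = (mu P / 2 * v_dc_ref P) \<cdot>\<^sub>v (Rot \<gamma> *\<^sub>v ones n)"
  define i where "i = Y P B *\<^sub>v e"
  define v where "v = mat_inv (Z_net P B) *\<^sub>v i"
  define l where "l = mat_inv (Z_line P m) *\<^sub>v ((B_ext B)\<^sup>T *\<^sub>v v)"
  define u where "u = xi P \<cdot>\<^sub>v (((Rot \<gamma>)\<^sup>T * Y P B * Rot \<gamma>) *\<^sub>v ones n)"
  have e: "e \<in> carrier_vec (2 * n)" using R ones by (simp add: e_def)
  have i: "i \<in> carrier_vec (2 * n)" using e inv_total(3) by (simp add: i_def)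
  have v: "v \<in> carrier_vec (2 * n)" using i inv_net(3) by (simp add: v_def)
  have BTv: "(B_ext B)\<^sup>T *\<^sub>v v \<in> carrier_vec (2 * m)" using v BE by simp
  have l: "l \<in> carrier_vec (2 * m)" using BTv inv_line(3) by (simp add: l_def)

  have line_eq: "Z_line P m *\<^sub>v l = (B_ext B)\<^sup>T *\<^sub>v v"
    unfolding l_def using C(1) inv_line BTv by (simp flip: assoc_mult_mat_vec)
  \<comment> \<open>Expanding \<open>Z_net\<close> undoes the elimination of the line currents and
    recovers the current balance at the nodes.\<close>
  have "i = Z_net P B *\<^sub>v v"
    unfolding v_def using C(4) inv_net i by (simp flip: assoc_mult_mat_vec)
  also have "\<dots> = Z_C P n *\<^sub>v v + (B_ext B * mat_inv (Z_line P m) * (B_ext B)\<^sup>T) *\<^sub>v v"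
    unfolding Z_net_def dimB using C(2) BE inv_line(3) v
    by (intro add_mult_distrib_mat_vec) auto
  also have "(B_ext B * mat_inv (Z_line P m) * (B_ext B)\<^sup>T) *\<^sub>v v = B_ext B *\<^sub>v l"
    unfolding l_def using BE inv_line(3) v by (intro mult_mat3_vec) auto
  finally have node_eq: "i = Z_C P n *\<^sub>v v + B_ext B *\<^sub>v l" .
  have node_injection: "- (Z_C P n *\<^sub>v v) + i - B_ext B *\<^sub>v l = 0\<^sub>v (2 * n)"
    unfolding node_eq using C(2) v BE l by (intro eq_vecI) auto
  \<comment> \<open>Likewise, expanding \<open>Z_total\<close> recovers the filter equation, since
    its second summand applied to \<open>i\<close> is \<open>v\<close>.\<close>
  have "e = Z_total P B *\<^sub>v i"
    unfolding i_def using C(5) inv_total e by (simp flip: assoc_mult_mat_vec)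
  also have "\<dots> = Z_R P n *\<^sub>v i + v"
    unfolding Z_total_def dimB v_def using C(3) inv_net(3) i
    by (intro add_mult_distrib_mat_vec) auto
  finally have filter_eq: "e = Z_R P n *\<^sub>v i + v" .
  \<comment> \<open>This is the DC balance at zero deviation. The constant \<open>xi\<close> is the
    product of the factor \<open>mu P / 2\<close> of that equation and the factor
    \<open>mu P / 2 * v_dc_ref P\<close> carried by \<open>e\<close>.\<close>
  have u: "u = (mu P / 2) \<cdot>\<^sub>v ((Rot \<gamma>)\<^sup>T *\<^sub>v i)"
  proof -
    have "((Rot \<gamma>)\<^sup>T * Y P B * Rot \<gamma>) *\<^sub>v ones n = (Rot \<gamma>)\<^sup>T *\<^sub>v (Y P B *\<^sub>v (Rot \<gamma> *\<^sub>v ones n))"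
      by (rule mult_mat3_vec[OF RT inv_total(3) R ones])
    moreover have "(Rot \<gamma>)\<^sup>T *\<^sub>v i
        = (mu P / 2 * v_dc_ref P) \<cdot>\<^sub>v ((Rot \<gamma>)\<^sup>T *\<^sub>v (Y P B *\<^sub>v (Rot \<gamma> *\<^sub>v ones n)))"
      unfolding i_def e_def using R RT inv_total(3) ones
      by (simp add: mult_mat_vec[of _ _ "2 * n"])
    ultimately show ?thesis
      by (simp add: u_def xi_def smult_smult_assoc power2_eq_square mult.assoc)
  qed
  have uc: "u \<in> carrier_vec n" unfolding u using RT i by simp
  have source_eq: "(mu P / 2) \<cdot>\<^sub>v (Rot \<gamma> *\<^sub>v (0\<^sub>v n + v_dc_ref P \<cdot>\<^sub>v ones n)) = e"
    using R ones by (simp add: e_def smult_smult_assoc mult_mat_vec[OF R ones])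

  \<comment> \<open>The zero deviation is forced: at rest the angle equation reads
    \<open>eta\<close> times the deviation equals zero, and \<open>eta\<close> is positive.\<close>
  define z where "z = \<lparr>angles = \<gamma>, dc_dev = 0\<^sub>v n, i_ac = i, v_ac = v, i_line = l\<rparr>"
  have "z \<in> state_space n m"
    using assms(4) i v l by (simp add: z_def state_space_def)
  moreover have "vector_field P B z u = (0\<^sub>v n, 0\<^sub>v n, 0\<^sub>v (2 * n), 0\<^sub>v (2 * n), 0\<^sub>v (2 * m))"
  proof -
    have "eta P \<cdot>\<^sub>v 0\<^sub>v n = 0\<^sub>v n"
      by (intro eq_vecI) auto
    \<comment> \<open>Rewriting the \<open>Rot\<close> term back to \<open>u\<close> makes it cancel
      against the input.\<close>
    moreover have "(1 / C_dc P) \<cdot>\<^sub>v (- (K_p P \<cdot>\<^sub>v 0\<^sub>v n) - (mu P / 2) \<cdot>\<^sub>v ((Rot \<gamma>)\<^sup>T *\<^sub>v i) + u) = 0\<^sub>v n"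
      using uc unfolding u[symmetric] by (intro eq_vecI) auto
    moreover have "(1 / L_f P) \<cdot>\<^sub>v (- (Z_R P n *\<^sub>v i) + e - v) = 0\<^sub>v (2 * n)"
      unfolding filter_eq using C(3) i v by (intro eq_vecI) auto
    moreover have "(1 / C_f P) \<cdot>\<^sub>v (- (Z_C P n *\<^sub>v v) + i - B_ext B *\<^sub>v l) = 0\<^sub>v (2 * n)"
      unfolding node_injection using BE l by (intro eq_vecI) auto
    moreover have "(1 / L_line P) \<cdot>\<^sub>v (- (Z_line P m *\<^sub>v l) + (B_ext B)\<^sup>T *\<^sub>v v) = 0\<^sub>v (2 * m)"
      unfolding line_eq using BTv by (intro eq_vecI) auto
    ultimately show ?thesis
      by (simp add: vector_field_def z_def dimB source_eq)
  qed
  ultimately have "feasible_input P B \<gamma> u"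
    using uc unfolding feasible_input_def steady_state_def by (auto simp: dimB z_def)
  moreover have "xi P > 0"
    using assms(1) by (simp add: xi_def valid_params_def)
  ultimately show ?thesis
    using pos(1) net total by (simp add: u_def pos_quad_form_invertible)
qed

end
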